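(* Let $A:=\begin{bmatrix}A_{11}&A_{12}\\ 0&A_{22}\end{bmatrix}$ and $E:=\begin{bmatrix}E_{11}&E_{12}\\ E_{21}&E_{22}\end{bmatrix}$ be $n\times n$ complex matrices, where $A_{11}$ and $E_{11}$ are $m\times m$ matrices. Suppose that $s:=\mathrm{sep}(A_{22},A_{11})>0$ and $4\|E\|_2(\|E\|_2+\|A_{12}\|_2)<s^2$. Define $\phi(\epsilon):=\sqrt{\epsilon(\epsilon+\|A_{12}\|_2)}$ for $\epsilon\ge 0$. Then the following hold. (a) There exists a unique matrix $X\in\mathbb{C}^{(n-m)\times m}$ such that $$\begin{bmatrix}I_m&0\\ X&I_{n-m}\end{bmatrix}^{-1}\begin{bmatrix}A_{11}+E_{11}&A_{12}+E_{12}\\ E_{21}&A_{22}+E_{22}\end{bmatrix}\begin{bmatrix}I_m&0\\ X&I_{n-m}\end{bmatrix}=\begin{bmatrix}M&A_{12}+E_{12}\\ 0&N\end{bmatrix},$$ where $M:=A_{11}+E_{11}+(A_{12}+E_{12})X$ and $N:=A_{22}+E_{22}-X(A_{12}+E_{12})$. Further, $$\|X\|_2\le\frac{2\|E\|_2}{s+\sqrt{s^2-4(\|A_{12}\|_2+\|E\|_2)\|E\|_2}}\le\frac{2\|E\|_2}{s}.$$ (b) $\mathrm{eig}_{\phi(\|E\|_2)}(A_{11})\cap\mathrm{eig}_{\phi(\|E\|_2)}(A_{22})=\emptyset$. (c) $\mathrm{eig}(M)\subset\mathrm{eig}_{\phi(\|E\|_2)}(A_{11})$ and $\mathrm{ei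g}(N)\subset\mathrm{eig}_{\phi(\|E\|_2)}(A_{22})$.
   Context: $\|\cdot\|_2$ is the spectral norm of matrices, $I_k$ is the $k\times k$ identity matrix, and $\mathrm{eig}(B)$ is the set of eigenvalues of a square matrix $B$. The matrices $A$ and $E$ are partitioned conformably. For $B\in\mathbb{C}^{p\times p}$ and $C\in\mathbb{C}^{q\times q}$, $\mathrm{sep}(B,C):=\min\{\|BY-YC\|_2: Y\in\mathbb{C}^{p\times q},\ \|Y\|_2=1\}$. For $\epsilon\ge 0$ and $B\in\mathbb{C}^{p\times p}$, the $\epsilon$-pseudospectrum is $\mathrm{eig}_\epsilon(B):=\bigcup\{\mathrm{eig}(B+F): F\in\mathbb{C}^{p\times p},\ \|F\|_2\le\epsilon\}$, so $\mathrm{eig}_0(B)=\mathrm{eig}(B)$.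
   Formalization: In (a), X is unique only among solutions with ‖X‖₂ ≤ 2‖E‖₂/s, and (c) concerns this X; without the bound uniqueness fails, e.g. m=1, n=2, A₁₁=0, A₁₂=A₂₂=1, E=0, where X=0 and X=1 both satisfy the similarity. *)

theory Defs
  imports "HOL-Analysis.Analysis"
begin

text \<open>
  A \<open>p \<times> q\<close> complex matrix has type \<open>complex ^ 'q ^ 'p\<close> with \<open>CARD('p) = p\<close> and \<open>CARD('q) = q\<close>.
  The norm on \<open>complex ^ 'n\<close> is the Euclidean one, so \<open>onorm\<close> yields the spectral norm; the library
  instance \<open>norm\<close> on matrices is the Frobenius norm and is not used.
\<close>

definition spec_norm :: "complex ^ 'q ^ 'p \<Rightarrow> real" where
  "spec_norm A = onorm (\<lambda>x. A *v x)"

definition eig :: "complex ^ 'n ^ 'n \<Rightarrow> complex set" where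
  "eig B = {z. \<exists>v. v \<noteq> 0 \<and> B *v v = z *s v}"

definition eig_eps :: "real \<Rightarrow> complex ^ 'n ^ 'n \<Rightarrow> complex set" where
  "eig_eps \<epsilon> B = \<Union> {eig (B + F) | F. spec_norm F \<le> \<epsilon>}"

text \<open>The infimum below is attained (lemma \<open>sep_attained\<close>), so it is a minimum.\<close>

definition sep :: "complex ^ 'p ^ 'p \<Rightarrow> complex ^ 'q ^ 'q \<Rightarrow> real" where
  "sep B C = Inf {spec_norm (B ** Y - Y ** C) | Y :: complex ^ 'q ^ 'p. spec_norm Y = 1}"

definition block_mat ::
  "'a ^ 'm ^ 'm \<Rightarrow> 'a ^ 'k ^ 'm \<Rightarrow> 'a ^ 'm ^ 'k \<Rightarrow> 'a ^ 'k ^ 'k \<Rightarrow> 'a ^ ('m + 'k) ^ ('m + 'k)" where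
  "block_mat P Q R S = (\<chi> i j.
     case i of
       Inl i' \<Rightarrow> (case j of Inl j' \<Rightarrow> P $ i' $ j' | Inr j' \<Rightarrow> Q $ i' $ j')
     | Inr i' \<Rightarrow> (case j of Inl j' \<Rightarrow> R $ i' $ j' | Inr j' \<Rightarrow> S $ i' $ j'))"

lemma bounded_linear_mv: "bounded_linear (\<lambda>x. (A :: complex ^ 'q ^ 'p) *v x)"
  by (rule matrix_vector_mul_bounded_linear)

lemma spec_norm_nonneg: "0 \<le> spec_norm A"
  unfolding spec_norm_def by (rule onorm_pos_le[OF bounded_linear_mv])

lemma spec_norm_triangle: "spec_norm (A + B) \<le> spec_norm A + spec_norm B"
  unfolding spec_norm_def matrix_vector_mult_add_rdistrib
  by (rule onorm_triangle[OF bounded_linear_mv bounded_linear_mv])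

lemma scaleR_mv: "(r *\<^sub>R (A :: complex ^ 'q ^ 'p)) *v x = r *\<^sub>R (A *v x)"
  by (simp add: vec_eq_iff matrix_vector_mult_def scaleR_sum_right)

lemma spec_norm_scaleR: "spec_norm (r *\<^sub>R A) = \<bar>r\<bar> * spec_norm A"
  unfolding spec_norm_def scaleR_mv by (rule onorm_scaleR[OF bounded_linear_mv])

lemma spec_norm_eq_0: "spec_norm A = 0 \<longleftrightarrow> A = 0"
  unfolding spec_norm_def onorm_eq_0[OF bounded_linear_mv]
  by (metis matrix_eq matrix_vector_mult_0)

lemma convex_on_spec_norm: "convex_on UNIV spec_norm"
proof (rule convex_onI)
  fix t :: real and x y :: "complex ^ 'a ^ 'b"
  assume "0 < t" "t < 1"
  then show "spec_norm ((1 - t) *\<^sub>R x + t *\<^sub>R y) \<le> (1 - t) * spec_norm x + t * spec_norm y"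
    using spec_norm_triangle[of "(1 - t) *\<^sub>R x" "t *\<^sub>R y"] by (simp add: spec_norm_scaleR)
qed simp

lemma continuous_on_spec_norm: "continuous_on S spec_norm"
  using convex_on_continuous[OF open_UNIV convex_on_spec_norm] continuous_on_subset by blast

lemma compact_spec_norm_sphere: "compact {Y :: complex ^ 'q ^ 'p. spec_norm Y = 1}"
proof -
  let ?S = "sphere 0 1 :: (complex ^ 'q ^ 'p) set"
  have "?S \<noteq> {}" by simp
  then obtain Z where Z: "Z \<in> ?S" "\<And>Y. Y \<in> ?S \<Longrightarrow> spec_norm Z \<le> spec_norm Y"
    using continuous_attains_inf[OF compact_sphere _ continuous_on_spec_norm, of 0 1] by blast
  have pos: "spec_norm Z > 0"
    using Z(1) spec_norm_nonneg[of Z] spec_norm_eq_0[of Z] by (cases "Z = 0") auto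
  have "norm Y \<le> 1 / spec_norm Z" if "spec_norm Y = 1" for Y :: "complex ^ 'q ^ 'p"
  proof -
    have "Y \<noteq> 0" using that spec_norm_eq_0[of Y] by auto
    then have "inverse (norm Y) *\<^sub>R Y \<in> ?S" by simp
    from Z(2)[OF this] have "spec_norm Z \<le> inverse (norm Y)"
      using that by (simp add: spec_norm_scaleR)
    then show ?thesis using pos \<open>Y \<noteq> 0\<close> by (simp add: field_simps)
  qed
  then have "bounded {Y :: complex ^ 'q ^ 'p. spec_norm Y = 1}"
    by (auto simp: bounded_iff)
  moreover have "closed {Y :: complex ^ 'q ^ 'p. spec_norm Y = 1}"
    by (intro closed_Collect_eq continuous_on_spec_norm continuous_on_const)
  ultimately show ?thesis by (simp add: compact_eq_bounded_closed)
qed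

lemma sep_attained:
  fixes B :: "complex ^ 'p ^ 'p" and C :: "complex ^ 'q ^ 'q"
  obtains Y :: "complex ^ 'q ^ 'p"
  where "spec_norm Y = 1" and "spec_norm (B ** Y - Y ** C) = sep B C"
    and "\<And>Z :: complex ^ 'q ^ 'p. spec_norm Z = 1 \<Longrightarrow> sep B C \<le> spec_norm (B ** Z - Z ** C)"
proof -
  let ?S = "{Y :: complex ^ 'q ^ 'p. spec_norm Y = 1}"
  let ?f = "\<lambda>Y :: complex ^ 'q ^ 'p. spec_norm (B ** Y - Y ** C)"
  have "(1 :: complex ^ 'q ^ 'p) \<noteq> 0" by (simp add: vec_eq_iff)
  then have "spec_norm (1 :: complex ^ 'q ^ 'p) > 0"
    using spec_norm_nonneg spec_norm_eq_0 by (metis order_le_less)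
  then have "spec_norm (inverse (spec_norm (1 :: complex ^ 'q ^ 'p)) *\<^sub>R (1 :: complex ^ 'q ^ 'p)) = 1"
    unfolding spec_norm_scaleR by simp
  then have "inverse (spec_norm (1 :: complex ^ 'q ^ 'p)) *\<^sub>R (1 :: complex ^ 'q ^ 'p) \<in> ?S"
    by (rule CollectI)
  then have "?S \<noteq> {}" by blast
  moreover have "continuous_on ?S ?f"
    by (intro continuous_on_compose2[OF continuous_on_spec_norm[of UNIV]])
       (auto simp: matrix_matrix_mult_def intro!: continuous_intros)
  ultimately obtain Y where Y: "Y \<in> ?S" "\<And>Z. Z \<in> ?S \<Longrightarrow> ?f Y \<le> ?f Z"
    using continuous_attains_inf[OF compact_spec_norm_sphere, of ?f] by blast
  have "sep B C = ?f Y"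
    unfolding sep_def by (rule cInf_eq_minimum) (use Y in auto)
  with Y show ?thesis by (intro that[of Y]) auto
qed

end

theory Submission
  imports Defs "HOL-Computational_Algebra.Fundamental_Theorem_Algebra"
begin

text \<open>
  Write \<open>\<epsilon> = \<parallel>E\<parallel>\<close>, \<open>a = \<parallel>A12\<parallel>\<close>, \<open>\<phi> = \<surd>(\<epsilon> (\<epsilon> + a))\<close>; the smallness hypothesis is \<open>2 \<phi> < s\<close>.
  A matrix \<open>X\<close> decouples \<open>A + E\<close> exactly when the lower left block of the transformed matrix
  vanishes (\<open>unit_triangular_similarity\<close>), which is the Riccati equation
  \<open>A22 X - X A11 = X A12 X - [-X I] E [I; X]\<close>.

  The right side has norm at most \<open>\<epsilon> + (\<epsilon> + a) \<parallel>X\<parallel>\<^sup>2\<close> and the left side at least \<open>s \<parallel>X\<parallel>\<close>. The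
  quadratic \<open>(\<epsilon> + a) x\<^sup>2 - s x + \<epsilon>\<close> has, for \<open>\<epsilon> > 0\<close>, two distinct positive roots; the smaller
  root \<open>r\<close> is the bound of the theorem. Brouwer's fixed point theorem on the ball of radius \<open>r\<close>
  gives a solution (\<open>riccati_solution_exists\<close>), and a solution of norm at most \<open>2 \<epsilon> / s\<close> cannot
  lie beyond the larger root, so it has norm at most \<open>r\<close> (\<open>smaller_root_bound\<close>).

  The two pseudospectra of radius \<open>\<phi>\<close> are disjoint: a common point would produce a rank-one \<open>Y\<close>
  with \<open>\<parallel>A22 Y - Y A11\<parallel> \<le> 2 \<phi> \<parallel>Y\<parallel>\<close> (\<open>sep_le_of_common_pseudo_eigenvalue\<close>).

  The location of \<open>eig M\<close> follows from a residual estimate. An eigenvector \<open>v\<close> of \<open>M\<close> gives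
  the eigenvector \<open>(v, X v)\<close> of \<open>A + E\<close>, so \<open>(v, X v)\<close> is an approximate eigenvector of \<open>A\<close> with
  residual \<open>\<epsilon>\<close>. The separation bounds the residuals of \<open>v\<close> for \<open>A11\<close> and of \<open>X v\<close> for \<open>A22\<close> from
  below jointly, and as \<open>X v\<close> is short, an elementary inequality leaves only a residual of at most
  \<open>\<phi>\<close> for \<open>A11\<close> (\<open>triangular_residual_ineq\<close>, \<open>block_eigenvector_pseudo_eigenvalue\<close>). The argument
  for \<open>N\<close> is the same after transposition.

  Uniqueness rests on these spectral inclusions: for two solutions \<open>X\<close> and \<open>Y\<close> of norm at most
  \<open>2 \<epsilon> / s\<close>, the difference \<open>D = X - Y\<close> satisfies \<open>N(Y) D = D M(X)\<close>, and the spectra of \<open>N(Y)\<close> and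
  \<open>M(X)\<close> are disjoint, which forces \<open>D = 0\<close> (\<open>intertwiner_eq_0\<close>).
\<close>

section \<open>Rectangular matrices\<close>

lemma matrix_diff_ldistrib: "A ** (B - C) = A ** B - A ** (C :: 'a::ring_1 ^ 'n ^ 'm)"
  by (simp add: matrix_matrix_mult_def vec_eq_iff right_diff_distrib sum_subtractf)

lemma matrix_diff_rdistrib: "(A - B) ** C = A ** C - B ** (C :: 'a::ring_1 ^ 'n ^ 'm)"
  by (simp add: matrix_matrix_mult_def vec_eq_iff left_diff_distrib sum_subtractf)

lemma matrix_add_rdistrib: "(A + B) ** C = A ** C + B ** (C :: 'a::ring_1 ^ 'n ^ 'm)"
  by (simp add: matrix_matrix_mult_def vec_eq_iff distrib_right sum.distrib)

lemmas matrix_distribs = matrix_add_ldistrib matrix_add_rdistrib matrix_diff_ldistrib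
  matrix_diff_rdistrib matrix_mul_assoc

lemma transpose_add: "transpose (A + B) = transpose A + transpose B"
  by (simp add: transpose_def vec_eq_iff)

lemma transpose_diff: "transpose (A - B) = transpose A - transpose B"
  by (simp add: transpose_def vec_eq_iff)

lemma transpose_zero: "transpose 0 = 0"
  by (simp add: transpose_def vec_eq_iff)

section \<open>The spectral norm\<close>

lemma norm_mv_le: "norm (A *v x) \<le> spec_norm A * norm x"
  unfolding spec_norm_def by (rule onorm[OF bounded_linear_mv])

lemma spec_norm_le: "0 \<le> b \<Longrightarrow> (\<And>x. norm (A *v x) \<le> b * norm x) \<Longrightarrow> spec_norm A \<le> b"
  unfolding spec_norm_def by (rule onorm_bound)

lemma spec_norm_mult: "spec_norm (A ** B) \<le> spec_norm A * spec_norm B"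
proof -
  have "norm ((A ** B) *v x) \<le> spec_norm A * spec_norm B * norm x" for x
    using norm_mv_le[of A "B *v x"] mult_left_mono[OF norm_mv_le[of B x] spec_norm_nonneg[of A]]
    by (simp add: matrix_vector_mul_assoc[symmetric])
  then show ?thesis by (simp add: spec_norm_le spec_norm_nonneg)
qed

lemma spec_norm_uminus: "spec_norm (- A) = spec_norm A"
  using spec_norm_scaleR[of "-1" A] by simp

lemma spec_norm_diff: "spec_norm (A - B) \<le> spec_norm A + spec_norm B"
  using spec_norm_triangle[of A "- B"] by (simp add: spec_norm_uminus)

text \<open>
  The dot product without conjugation: it pairs \<open>A\<close> with its plain transpose, which has the
  same eigenvalues as \<open>A\<close>, so that left eigenvectors need no conjugate eigenvalues.
\<close>

definition bilin :: "complex ^ 'n \<Rightarrow> complex ^ 'n \<Rightarrow> complex" where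
  "bilin u v = (\<Sum>i\<in>UNIV. u $ i * v $ i)"

definition outer :: "complex ^ 'p \<Rightarrow> complex ^ 'q \<Rightarrow> complex ^ 'q ^ 'p" where
  "outer v w = (\<chi> i j. v $ i * w $ j)"

lemma norm_bilin_le: "norm (bilin u v) \<le> norm u * norm v"
proof -
  have "norm (bilin u v) \<le> (\<Sum>i\<in>UNIV. \<bar>norm (u $ i)\<bar> * \<bar>norm (v $ i)\<bar>)"
    unfolding bilin_def by (rule order_trans[OF norm_sum]) (simp add: norm_mult)
  also have "\<dots> \<le> norm u * norm v"
    unfolding norm_vec_def by (rule L2_set_mult_ineq)
  finally show ?thesis .
qed

lemma bilin_commute: "bilin u v = bilin v u"
  by (simp add: bilin_def mult.commute)

lemma bilin_transpose: "bilin (transpose A *v x) y = bilin x (A *v y)"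
proof -
  have "bilin (transpose A *v x) y = (\<Sum>i\<in>UNIV. \<Sum>j\<in>UNIV. A $ j $ i * x $ j * y $ i)"
    by (simp add: bilin_def matrix_vector_mult_def transpose_def sum_distrib_right
        del: transpose_matrix_vector)
  also have "\<dots> = (\<Sum>j\<in>UNIV. \<Sum>i\<in>UNIV. A $ j $ i * x $ j * y $ i)"
    by (rule sum.swap)
  also have "\<dots> = bilin x (A *v y)"
    by (simp add: bilin_def matrix_vector_mult_def sum_distrib_left mult_ac)
  finally show ?thesis .
qed

text \<open>
  The entrywise conjugate \<open>u\<close> of \<open>v\<close> recovers the Hermitian length of \<open>v\<close> from the bilinear
  pairing; it is the norming vector in duality arguments.
\<close>

lemma exists_conj:
  fixes v :: "complex ^ 'n"
  obtains u where "norm u = norm v" "bilin u v = of_real ((norm v)\<^sup>2)"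
proof
  let ?u = "\<chi> i. cnj (v $ i)"
  show "norm ?u = norm v" by (simp add: norm_vec_def)
  have "bilin ?u v = (\<Sum>i\<in>UNIV. of_real ((norm (v $ i))\<^sup>2))"
    by (simp add: bilin_def complex_norm_square mult.commute del: of_real_power)
  also have "\<dots> = of_real ((norm v)\<^sup>2)"
    by (simp add: norm_vec_def L2_set_def sum_nonneg)
  finally show "bilin ?u v = of_real ((norm v)\<^sup>2)" .
qed

text \<open>
  Duality: if \<open>u\<close> norms \<open>y = A\<^sup>T x\<close>, then \<open>\<parallel>y\<parallel>\<^sup>2\<close> is the pairing of \<open>x\<close> with \<open>A u\<close>, and Cauchy-Schwarz
  bounds it by \<open>\<parallel>x\<parallel> \<parallel>A\<parallel> \<parallel>y\<parallel>\<close>.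
\<close>

lemma spec_norm_transpose_le: "spec_norm (transpose A) \<le> spec_norm A"
proof (rule spec_norm_le[OF spec_norm_nonneg])
  fix x
  let ?y = "transpose A *v x"
  obtain u where u: "norm u = norm ?y" "bilin u ?y = of_real ((norm ?y)\<^sup>2)"
    by (rule exists_conj)
  have "(norm ?y)\<^sup>2 = norm (bilin ?y u)"
    using u(2) by (simp add: bilin_commute norm_power del: transpose_matrix_vector)
  also have "\<dots> = norm (bilin x (A *v u))" by (simp only: bilin_transpose)
  also have "\<dots> \<le> norm x * (spec_norm A * norm u)"
    by (rule order_trans[OF norm_bilin_le mult_left_mono[OF norm_mv_le norm_ge_zero]])
  finally have "norm ?y * norm ?y \<le> (spec_norm A * norm x) * norm ?y"
    unfolding u(1) by (simp add: power2_eq_square mult_ac del: transpose_matrix_vector)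
  then show "norm ?y \<le> spec_norm A * norm x"
    by (cases "norm ?y = 0")
       (simp_all add: spec_norm_nonneg mult_le_cancel_right del: transpose_matrix_vector)
qed

lemma spec_norm_transpose: "spec_norm (transpose A) = spec_norm A"
  using spec_norm_transpose_le[of A] spec_norm_transpose_le[of "transpose A"] by simp

lemma norm_vec_smult: "norm (c *s v) = norm c * norm (v :: complex ^ 'n)"
  by (simp add: norm_vec_def norm_mult L2_set_right_distrib)

lemma outer_mv: "outer v w *v x = bilin w x *s v"
  by (simp add: outer_def bilin_def matrix_vector_mult_def vec_eq_iff sum_distrib_left
      sum_distrib_right mult_ac)

lemma spec_norm_outer_le: "spec_norm (outer v w) \<le> norm v * norm w"
proof (rule spec_norm_le)
  show "norm (outer v w *v x) \<le> norm v * norm w * norm x" for x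
    using mult_left_mono[OF norm_bilin_le[of w x] norm_ge_zero[of v]]
    by (simp add: outer_mv norm_vec_smult mult_ac)
qed simp

lemma mult_outer: "B ** outer v w = outer (B *v v) w"
  by (simp add: outer_def matrix_matrix_mult_def matrix_vector_mult_def vec_eq_iff
      sum_distrib_right mult.assoc)

lemma outer_mult: "outer v w ** C = outer v (transpose C *v w)"
  by (simp add: outer_def matrix_matrix_mult_def matrix_vector_mult_def vec_eq_iff transpose_def
      sum_distrib_left mult_ac del: transpose_matrix_vector)

lemma outer_eq_0_iff: "outer v w = 0 \<longleftrightarrow> v = 0 \<or> w = 0"
  by (auto simp: outer_def vec_eq_iff)

lemma outer_smult: "outer (c *s v) w = outer v (c *s w)"
  by (simp add: outer_def vec_eq_iff)

section \<open>Pseudospectra and the separation of two matrices\<close>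

lemma eig_iff_det: "z \<in> eig B \<longleftrightarrow> det (B - mat z) = 0"
proof -
  have "mat z *v v = z *s v" for v :: "complex ^ 'a"
    by (simp add: mat_def matrix_vector_mult_def vec_eq_iff if_distrib[of "\<lambda>x. x * _"] cong: if_cong)
  then have "B *v v = z *s v \<longleftrightarrow> (B - mat z) *v v = 0" for v
    by (simp add: matrix_vector_mult_diff_rdistrib)
  then have "z \<in> eig B \<longleftrightarrow> \<not> invertible (B - mat z)"
    unfolding eig_def invertible_left_inverse matrix_left_invertible_ker by auto
  then show ?thesis by (simp add: invertible_det_nz)
qed

lemma eig_transpose: "eig (transpose B) = eig B"
proof (rule set_eqI)
  fix z
  have "transpose B - mat z = transpose (B - mat z)" by (simp add: transpose_diff)
  then show "z \<in> eig (transpose B) \<longleftrightarrow> z \<in> eig B" by (simp add: eig_iff_det)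
qed

lemma eig_eps_transpose_subset: "eig_eps \<epsilon> B \<subseteq> eig_eps \<epsilon> (transpose B)"
proof
  fix z assume "z \<in> eig_eps \<epsilon> B"
  then obtain F where F: "spec_norm F \<le> \<epsilon>" "z \<in> eig (B + F)" by (auto simp: eig_eps_def)
  then have "z \<in> eig (transpose B + transpose F)"
    by (metis eig_transpose transpose_add)
  moreover have "spec_norm (transpose F) \<le> \<epsilon>" using F(1) by (simp only: spec_norm_transpose)
  ultimately show "z \<in> eig_eps \<epsilon> (transpose B)"
    unfolding eig_eps_def by blast
qed

lemma eig_eps_transpose: "eig_eps \<epsilon> (transpose B) = eig_eps \<epsilon> B"
  using eig_eps_transpose_subset[of \<epsilon> B] eig_eps_transpose_subset[of \<epsilon> "transpose B"] by auto

text \<open>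
  An approximate eigenvector \<open>v\<close> with residual \<open>r\<close> is an exact eigenvector of \<open>B + F\<close>, where \<open>F\<close> is
  the rank-one matrix \<open>- r v\<^sup>H / \<parallel>v\<parallel>\<^sup>2\<close> of norm \<open>\<parallel>r\<parallel> / \<parallel>v\<parallel>\<close>.
\<close>

lemma eig_epsI:
  assumes v: "v \<noteq> 0" and r: "norm (B *v v - z *s v) \<le> \<epsilon> * norm v"
  shows "z \<in> eig_eps \<epsilon> B"
proof -
  obtain u where u: "norm u = norm v" "bilin u v = of_real ((norm v)\<^sup>2)"
    by (rule exists_conj)
  let ?r = "B *v v - z *s v"
  let ?c = "inverse ((norm v)\<^sup>2)"
  define F where "F = ?c *\<^sub>R outer (- ?r) u"
  have "bilin u v *s x = ((norm v)\<^sup>2) *\<^sub>R x" for x :: "complex ^ 'a"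
    unfolding u(2) vec_eq_iff
    by (simp add: vector_scaleR_component scaleR_conv_of_real[where 'a = complex])
  then have F: "F *v v = ?c *\<^sub>R ((norm v)\<^sup>2 *\<^sub>R (- ?r))"
    by (simp only: F_def scaleR_mv outer_mv)
  have "F *v v = - ?r" unfolding F using v by simp
  then have "(B + F) *v v = z *s v" by (simp add: matrix_vector_mult_add_rdistrib)
  moreover have "spec_norm F \<le> \<epsilon>"
  proof -
    have "spec_norm F \<le> ?c * (norm ?r * norm u)"
      using spec_norm_outer_le[of "- ?r" u]
      by (simp add: F_def spec_norm_scaleR mult_left_mono norm_minus_commute)
    also have "\<dots> = norm ?r / norm v"
      using v by (simp add: u(1) power2_eq_square field_simps)
    also have "\<dots> \<le> \<epsilon>" using r v by (simp add: pos_divide_le_eq)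
    finally show ?thesis .
  qed
  ultimately show ?thesis using v by (auto simp: eig_eps_def eig_def)
qed

lemma sep_mult_le: "sep B C * spec_norm Y \<le> spec_norm (B ** Y - Y ** C)"
proof (cases "Y = 0")
  case True
  then show ?thesis using spec_norm_nonneg spec_norm_eq_0[of Y] by simp
next
  case False
  let ?c = "inverse (spec_norm Y)"
  have pos: "spec_norm Y > 0"
    using False spec_norm_nonneg[of Y] spec_norm_eq_0[of Y] by linarith
  then have "spec_norm (?c *\<^sub>R Y) = 1" by (simp add: spec_norm_scaleR)
  then have "sep B C \<le> spec_norm (B ** (?c *\<^sub>R Y) - (?c *\<^sub>R Y) ** C)"
    using sep_attained[of B C] by metis
  also have "B ** (?c *\<^sub>R Y) - (?c *\<^sub>R Y) ** C = ?c *\<^sub>R (B ** Y - Y ** C)"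
    by (simp add: matrix_matrix_mult_def vec_eq_iff scaleR_sum_right scaleR_right_diff_distrib)
  also have "spec_norm \<dots> = ?c * spec_norm (B ** Y - Y ** C)"
    using pos by (simp add: spec_norm_scaleR)
  finally show ?thesis using pos by (simp add: field_simps)
qed

text \<open>
  Pseudospectra of small radii are disjoint. If \<open>z\<close> is an eigenvalue of \<open>B + F\<close> with eigenvector
  \<open>v\<close> and of \<open>C + G\<close> with left eigenvector \<open>w\<close>, then \<open>Y = v w\<^sup>T\<close> satisfies \<open>(B + F) Y = Y (C + G)\<close>.
  Hence \<open>B Y - Y C = Y G - F Y\<close> has norm at most \<open>(\<delta> + \<eta>) \<parallel>Y\<parallel>\<close>, while the separation makes it
  at least \<open>sep B C \<parallel>Y\<parallel>\<close>.
\<close>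

lemma sep_le_of_common_pseudo_eigenvalue:
  fixes B :: "complex ^ 'p ^ 'p" and C :: "complex ^ 'q ^ 'q"
  assumes zB: "z \<in> eig_eps \<delta> B" and zC: "z \<in> eig_eps \<eta> C"
  shows "sep B C \<le> \<delta> + \<eta>"
proof -
  obtain F v where F: "spec_norm F \<le> \<delta>" "v \<noteq> 0" "(B + F) *v v = z *s v"
    using zB by (auto simp: eig_eps_def eig_def)
  obtain G where G: "spec_norm G \<le> \<eta>" "z \<in> eig (C + G)"
    using zC by (auto simp: eig_eps_def)
  then have "z \<in> eig (transpose (C + G))" by (simp only: eig_transpose)
  then obtain w where w: "w \<noteq> 0" "transpose (C + G) *v w = z *s w"
    unfolding eig_def by blast
  define Y where "Y = outer v w"
  have "(B + F) ** Y = Y ** (C + G)"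
    unfolding Y_def mult_outer outer_mult F(3) w(2) by (rule outer_smult)
  then have "B ** Y - Y ** C = Y ** G - F ** Y"
    by (simp add: matrix_distribs algebra_simps)
  then have "sep B C * spec_norm Y \<le> spec_norm (Y ** G - F ** Y)"
    using sep_mult_le[of B C Y] by simp
  also have "\<dots> \<le> spec_norm Y * spec_norm G + spec_norm F * spec_norm Y"
    by (intro order_trans[OF spec_norm_diff] add_mono spec_norm_mult)
  also have "\<dots> \<le> spec_norm Y * \<eta> + \<delta> * spec_norm Y"
    by (intro add_mono mult_left_mono mult_right_mono F(1) G(1) spec_norm_nonneg)
  finally have "sep B C * spec_norm Y \<le> (\<delta> + \<eta>) * spec_norm Y"
    by (simp add: algebra_simps)
  moreover have "Y \<noteq> 0" using F(2) w(1) by (simp add: Y_def outer_eq_0_iff)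
  then have "spec_norm Y > 0"
    using spec_norm_nonneg[of Y] spec_norm_eq_0[of Y] by linarith
  ultimately show ?thesis by simp
qed

section \<open>Approximate eigenvectors of block triangular matrices\<close>

text \<open>
  The scalar inequality behind the pseudospectral bounds. It is used with a vector \<open>(v, w)\<close>,
  \<open>\<parallel>v\<parallel> = 1\<close>, \<open>\<parallel>w\<parallel> = y\<close>, and with \<open>p\<close> and \<open>q\<close> the residuals of \<open>v\<close> and \<open>w\<close> for the two diagonal
  blocks of a block triangular matrix whose off-diagonal block has norm \<open>a\<close>.

  If both residual ratios were exactly \<open>\<phi>\<close>, i.e. \<open>p = \<phi>\<close> and \<open>q = \<phi> y\<close>, the left side of \<open>res\<close>
  would already reach the right side: \<open>\<epsilon>\<close> is the smallest singular value of the matrix with rows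
  \<open>(\<phi>, -a)\<close> and \<open>(0, \<phi>)\<close>, because its singular values have product \<open>\<phi>\<^sup>2 = \<epsilon> (\<epsilon> + a)\<close> and
  difference \<open>a\<close>. If \<open>p = \<phi> + d\<close> with \<open>d > 0\<close>, the separation only forces \<open>q \<ge> (\<phi> - d) y\<close>; but
  since \<open>y\<close> is small, what \<open>d\<close> adds to the first square outweighs what it removes from the second.
\<close>

lemma triangular_residual_ineq:
  fixes \<epsilon> a \<phi> s p q y :: real
  assumes nn: "0 \<le> \<epsilon>" "0 \<le> a" "0 \<le> \<phi>" "0 \<le> q" "0 \<le> y"
    and phi: "\<phi>\<^sup>2 = \<epsilon> * (\<epsilon> + a)" "2 * \<phi> < s"
    and y: "s * y \<le> 2 * \<epsilon>"
    and sep: "s * y \<le> p * y + q"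
    and res: "a * y \<le> p \<Longrightarrow> (p - a * y)\<^sup>2 + q\<^sup>2 \<le> \<epsilon>\<^sup>2 * (1 + y\<^sup>2)"
  shows "p \<le> \<phi>"
proof (rule ccontr)
  assume "\<not> p \<le> \<phi>"
  then have p: "\<phi> < p" by simp
  \<comment> \<open>Since \<open>2 \<phi> < s\<close>, the bound on \<open>s y\<close> keeps \<open>y\<close> below \<open>\<epsilon> / \<phi>\<close>.\<close>
  have yphi: "\<phi> * y \<le> \<epsilon>"
    using mult_right_mono[of "2 * \<phi>" s y] phi(2) nn y by simp
  have ay: "a * y \<le> \<phi>"
  proof (cases "\<phi> = 0")
    case True
    then have "\<epsilon> = 0" using phi(1) nn by (auto simp: add_nonneg_eq_0_iff)
    then have "y = 0" using y True phi(2) nn by (simp add: mult_le_0_iff)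
    then show ?thesis using True by simp
  next
    case False
    have "\<phi> * (a * y) \<le> a * \<epsilon>"
      using mult_left_mono[OF yphi nn(2)] by (simp add: mult_ac)
    also have "\<dots> \<le> \<phi> * \<phi>" using phi(1) nn by (simp add: power2_eq_square algebra_simps)
    finally show ?thesis using False nn by simp
  qed
  have res': "(p - a * y)\<^sup>2 + q\<^sup>2 \<le> \<epsilon>\<^sup>2 * (1 + y\<^sup>2)" using res ay p by simp
  \<comment> \<open>For \<open>\<phi> > 0\<close> this is \<open>y\<^sup>2 + (a / \<phi>) y \<le> 1\<close>, which holds with equality at \<open>y = \<epsilon> / \<phi>\<close>; it decides the sign of the term linear in \<open>d\<close> below.\<close>
  have key: "\<phi> * y\<^sup>2 \<le> \<phi> - a * y"
  proof (cases "\<phi> = 0")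
    case True
    then show ?thesis using ay by simp
  next
    case False
    have "\<phi>\<^sup>2 * y\<^sup>2 \<le> \<epsilon>\<^sup>2"
      using power_mono[OF yphi, of 2] nn by (simp add: power_mult_distrib)
    moreover have "\<phi> * (a * y) \<le> a * \<epsilon>"
      using mult_left_mono[OF yphi nn(2)] by (simp add: mult_ac)
    ultimately have "\<phi> * (\<phi> * y\<^sup>2) \<le> \<phi> * (\<phi> - a * y)"
      using phi(1) by (simp add: power2_eq_square algebra_simps)
    then show ?thesis using False nn by simp
  qed
  \<comment> \<open>The case \<open>p = \<phi>\<close>, \<open>q = \<phi> y\<close>: the gap is \<open>a\<close> times a perfect square.\<close>
  have base: "\<epsilon>\<^sup>2 * (1 + y\<^sup>2) \<le> (\<phi> - a * y)\<^sup>2 + (\<phi> * y)\<^sup>2"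
  proof -
    let ?x = "sqrt \<epsilon>" and ?w = "sqrt (\<epsilon> + a)"
    have xw: "\<phi> = ?x * ?w"
      using phi(1) nn by (metis real_sqrt_mult real_sqrt_unique)
    have "(\<phi> - a * y)\<^sup>2 + (\<phi> * y)\<^sup>2 - \<epsilon>\<^sup>2 * (1 + y\<^sup>2) =
        (\<phi>\<^sup>2 - \<epsilon>\<^sup>2) - 2 * a * \<phi> * y + (a\<^sup>2 + \<phi>\<^sup>2 - \<epsilon>\<^sup>2) * y\<^sup>2"
      by (simp add: power2_eq_square algebra_simps)
    also have "\<dots> = a * (\<epsilon> - 2 * \<phi> * y + (\<epsilon> + a) * y\<^sup>2)"
      unfolding phi(1) by (simp add: power2_eq_square algebra_simps)
    also have "\<epsilon> - 2 * \<phi> * y + (\<epsilon> + a) * y\<^sup>2 = (?x - ?w * y)\<^sup>2"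
      unfolding xw using nn by (simp add: power2_diff power_mult_distrib)
    finally show ?thesis using nn by (smt (verit) mult_nonneg_nonneg zero_le_power2)
  qed
  \<comment> \<open>Truncating the excess at \<open>\<phi>\<close> keeps \<open>\<phi> - d\<close> nonnegative, so that squaring is monotone.\<close>
  define d where "d = min (p - \<phi>) \<phi>"
  have d: "0 \<le> d" "d \<le> \<phi>" "\<phi> + d \<le> p" using p nn by (auto simp: d_def)
  have q: "(\<phi> - d) * y \<le> q"
  proof (cases "p - \<phi> \<le> \<phi>")
    case True
    then have "(\<phi> - d) * y \<le> (s - p) * y"
      using phi(2) nn by (intro mult_right_mono) (auto simp: d_def)
    then show ?thesis using sep by (simp add: algebra_simps)
  qed (use nn in \<open>simp add: d_def\<close>)
  have "((\<phi> - d) * y)\<^sup>2 \<le> q\<^sup>2" using q d nn by (intro power_mono) auto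
  moreover have "(\<phi> + d - a * y)\<^sup>2 \<le> (p - a * y)\<^sup>2"
    using d ay by (intro power_mono) auto
  moreover have "(\<phi> + d - a * y)\<^sup>2 + ((\<phi> - d) * y)\<^sup>2 =
      (\<phi> - a * y)\<^sup>2 + (\<phi> * y)\<^sup>2 + 2 * d * (\<phi> - a * y - \<phi> * y\<^sup>2) + d\<^sup>2 * (1 + y\<^sup>2)"
    by (simp add: power2_eq_square algebra_simps)
  moreover have "0 \<le> 2 * d * (\<phi> - a * y - \<phi> * y\<^sup>2)" using d key by simp
  ultimately have "d\<^sup>2 * (1 + y\<^sup>2) \<le> 0" using base res' by linarith
  moreover have "d\<^sup>2 \<le> d\<^sup>2 * (1 + y\<^sup>2)" by (simp add: algebra_simps)
  ultimately have "d\<^sup>2 \<le> 0" by linarith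
  then have "d = 0" by simp
  \<comment> \<open>Only the degenerate case \<open>\<epsilon> = \<phi> = 0\<close> remains.\<close>
  then have "\<phi> = 0" using p by (auto simp: d_def min_def split: if_splits)
  then have "\<epsilon> = 0" using phi(1) nn by (auto simp: add_nonneg_eq_0_iff)
  then have "y = 0" using y \<open>\<phi> = 0\<close> phi(2) nn by (simp add: mult_le_0_iff)
  then have "p\<^sup>2 \<le> 0" using res' \<open>\<epsilon> = 0\<close> by (simp add: add_nonneg_nonneg sum_power2_le_zero_iff)
  then show False using p \<open>\<phi> = 0\<close> by simp
qed

lemma exists_unit_eigenvector:
  assumes "z \<in> eig B"
  obtains v where "norm v = 1" "B *v v = z *s v"
proof -
  obtain v where v: "v \<noteq> 0" "B *v v = z *s v" using assms by (auto simp: eig_def)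
  let ?c = "of_real (inverse (norm v)) :: complex"
  have "norm (?c *s v) = 1" using v(1) by (simp add: norm_vec_smult norm_inverse)
  moreover have "B *v (?c *s v) = z *s (?c *s v)"
    using v(2) by (simp add: vec.scale mult.commute)
  ultimately show ?thesis by (rule that)
qed

text \<open>
  Here \<open>(v, w)\<close> is an approximate eigenvector, with residual \<open>\<epsilon>\<close>, of the block triangular matrix
  with diagonal blocks \<open>P\<close>, \<open>Q\<close> and off-diagonal block \<open>B\<close>. A residual \<open>\<epsilon>\<close> places \<open>z\<close> in the
  pseudospectrum of \<open>P\<close> or of \<open>Q\<close>; that \<open>w\<close> is short compared with \<open>v\<close> decides for \<open>P\<close>. The
  separation is assumed for \<open>z\<close> only, in a form that is stable under transposing \<open>P\<close> and \<open>Q\<close>.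
\<close>

lemma block_eigenvector_pseudo_eigenvalue:
  fixes P :: "complex ^ 'p ^ 'p" and Q :: "complex ^ 'q ^ 'q" and B :: "complex ^ 'q ^ 'p"
  assumes v: "norm v = 1"
    and \<epsilon>: "0 \<le> \<epsilon>"
    and small: "4 * \<epsilon> * (\<epsilon> + spec_norm B) < s\<^sup>2" "0 < s"
    and w: "s * norm w \<le> 2 * \<epsilon>"
    and sep: "\<And>\<delta> \<eta>. z \<in> eig_eps \<delta> P \<Longrightarrow> z \<in> eig_eps \<eta> Q \<Longrightarrow> s \<le> \<delta> + \<eta>"
    and res: "(norm (P *v v - z *s v + B *v w))\<^sup>2 + (norm (Q *v w - z *s w))\<^sup>2
      \<le> \<epsilon>\<^sup>2 * (1 + (norm w)\<^sup>2)"
  shows "z \<in> eig_eps (sqrt (\<epsilon> * (\<epsilon> + spec_norm B))) P"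
proof -
  let ?a = "spec_norm B" and ?y = "norm w"
  define \<phi> where "\<phi> = sqrt (\<epsilon> * (\<epsilon> + ?a))"
  define p where "p = norm (P *v v - z *s v)"
  define q where "q = norm (Q *v w - z *s w)"
  have a: "0 \<le> ?a" by (rule spec_norm_nonneg)
  have phi2: "\<phi>\<^sup>2 = \<epsilon> * (\<epsilon> + ?a)" using \<epsilon> a by (simp add: \<phi>_def)
  have zP: "z \<in> eig_eps p P"
    using v by (intro eig_epsI[of v]) (auto simp: p_def)
  \<comment> \<open>The residuals themselves are radii of pseudospectra that contain \<open>z\<close>.\<close>
  have gap: "s * ?y \<le> p * ?y + q"
  proof (cases "w = 0")
    case False
    then have "z \<in> eig_eps (q / ?y) Q" by (intro eig_epsI[of w]) (auto simp: q_def)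
    from sep[OF zP this] show ?thesis using False by (simp add: field_simps)
  qed (simp add: q_def)
  have phi: "0 \<le> \<phi>" using \<epsilon> a by (simp add: \<phi>_def)
  have "(2 * \<phi>)\<^sup>2 < s\<^sup>2" using small(1) phi2 by (simp add: power_mult_distrib algebra_simps)
  then have phis: "2 * \<phi> < s" using power2_less_imp_less small(2) by fastforce
  have "p \<le> \<phi>"
  proof (rule triangular_residual_ineq)
    assume "?a * ?y \<le> p"
    moreover have "p - ?a * ?y \<le> norm (P *v v - z *s v + B *v w)"
      using norm_diff_ineq[of "P *v v - z *s v" "B *v w"] norm_mv_le[of B w] by (simp add: p_def)
    ultimately have "(p - ?a * ?y)\<^sup>2 \<le> (norm (P *v v - z *s v + B *v w))\<^sup>2"
      by (intro power_mono) auto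
    with res show "(p - ?a * ?y)\<^sup>2 + q\<^sup>2 \<le> \<epsilon>\<^sup>2 * (1 + ?y\<^sup>2)" by (simp add: q_def)
  qed (use \<epsilon> a phi phi2 phis w gap in \<open>simp_all add: q_def\<close>)
  moreover have "z \<in> eig_eps p P \<Longrightarrow> p \<le> \<phi> \<Longrightarrow> z \<in> eig_eps \<phi> P"
    by (force simp: eig_eps_def)
  ultimately show ?thesis using zP by (simp add: \<phi>_def)
qed

section \<open>Intertwining matrices\<close>

lemma mat_mult_nth: "(mat c ** (Y :: complex ^ 'n ^ 'm)) $ i $ j = c * Y $ i $ j"
  by (simp add: matrix_matrix_mult_def mat_def if_distrib[of "\<lambda>x. x * _"] cong: if_cong)

lemma mult_mat_mult: "N ** (mat c ** (Y :: complex ^ 'n ^ 'm)) = mat c ** (N ** Y)"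
proof -
  have "(N ** (mat c ** Y)) $ i $ j = (\<Sum>k\<in>UNIV. N $ i $ k * (mat c ** Y) $ k $ j)" for i j
    by (simp add: matrix_matrix_mult_def)
  also have "(\<Sum>k\<in>UNIV. N $ i $ k * (mat c ** Y) $ k $ j) = c * (N ** Y) $ i $ j" for i j
    unfolding mat_mult_nth by (simp add: matrix_matrix_mult_def sum_distrib_left mult_ac)
  finally show ?thesis by (simp add: vec_eq_iff mat_mult_nth)
qed

text \<open>
  Horner evaluation of \<open>D p(M)\<close>. Since \<open>D\<close> is rectangular, complex scalars act through scalar
  matrices on the left.
\<close>

definition poly_act :: "complex ^ 'q ^ 'p \<Rightarrow> complex ^ 'q ^ 'q \<Rightarrow> complex poly \<Rightarrow> complex ^ 'q ^ 'p" where
  "poly_act D M p = fold_coeffs (\<lambda>a Y. mat a ** D + Y ** M) p 0"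

lemma poly_act_0: "poly_act D M 0 = 0"
  by (simp add: poly_act_def)

lemma mat_0_mult: "mat 0 ** (Y :: complex ^ 'n ^ 'm) = 0"
  by (simp add: vec_eq_iff mat_mult_nth)

lemma zero_mult: "0 ** (Y :: complex ^ 'n ^ 'm) = 0"
  by (simp add: vec_eq_iff matrix_matrix_mult_def)

lemma poly_act_pCons: "poly_act D M (pCons a p) = mat a ** D + poly_act D M p ** M"
  by (cases "a = 0 \<and> p = 0") (auto simp: poly_act_def mat_0_mult zero_mult)

lemma poly_act_add: "poly_act D M (p + q) = poly_act D M p + poly_act D M q"
proof (induction p q rule: poly_induct2)
  case 0
  then show ?case by (simp add: poly_act_0)
next
  case (pCons a p b q)
  have "mat (a + b) ** D = mat a ** D + mat b ** D"
    by (simp add: vec_eq_iff mat_mult_nth distrib_right)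
  with pCons show ?case by (simp add: poly_act_pCons matrix_add_rdistrib)
qed

lemma poly_act_sum: "poly_act D M (\<Sum>i\<in>I. p i) = (\<Sum>i\<in>I. poly_act D M (p i))"
  by (induction I rule: infinite_finite_induct) (simp_all add: poly_act_0 poly_act_add)

lemma poly_act_smult: "poly_act D M (smult c p) = mat c ** poly_act D M p"
proof (induction p)
  case 0
  then show ?case by (simp add: poly_act_0 vec_eq_iff mat_mult_nth)
next
  case (pCons a p)
  have "mat (c * a) ** D = mat c ** (mat a ** D)"
    by (simp add: vec_eq_iff mat_mult_nth mult.assoc)
  with pCons show ?case by (simp add: poly_act_pCons matrix_add_ldistrib matrix_mul_assoc)
qed

lemma poly_act_intertwine:
  assumes "N ** D = D ** M"
  shows "N ** poly_act D M p = poly_act D M p ** M"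
proof (induction p)
  case 0
  then show ?case by (simp add: poly_act_0 vec_eq_iff matrix_matrix_mult_def)
next
  case (pCons a p)
  then show ?case
    by (simp add: poly_act_pCons matrix_add_ldistrib matrix_add_rdistrib mult_mat_mult assms)
       (simp add: matrix_mul_assoc)
qed

text \<open>
  The Krylov matrices \<open>D, D M, D M\<^sup>2, \<dots>\<close> are infinitely many members of a finite-dimensional real
  vector space, so a nontrivial linear relation holds among them.
\<close>

lemma exists_annihilating_poly:
  fixes D :: "complex ^ 'q ^ 'p"
  obtains p where "p \<noteq> 0" "poly_act D M p = 0"
proof -
  define n where "n = DIM(complex ^ 'q ^ 'p)"
  define K where "K i = poly_act D M (monom 1 i)" for i
  show ?thesis
  proof (cases "inj_on K {..n}")
    case False
    then obtain i j where ij: "i \<noteq> j" "K i = K j" by (auto simp: inj_on_def)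
    let ?p = "monom 1 i + smult (-1) (monom 1 j) :: complex poly"
    have "coeff ?p i = 1" using ij(1) by simp
    then have "?p \<noteq> 0" by (metis coeff_0 zero_neq_one)
    moreover have "poly_act D M ?p = 0"
      using ij(2) unfolding poly_act_add poly_act_smult K_def[symmetric]
      by (simp add: vec_eq_iff mat_mult_nth)
    ultimately show ?thesis by (rule that)
  next
    case True
    then have "card (K ` {..n}) = Suc n" by (simp add: card_image)
    then have "dependent (K ` {..n})"
      by (intro dependent_biggerset) (simp add: n_def)
    then obtain u where u: "\<exists>v\<in>K ` {..n}. u v \<noteq> 0" "(\<Sum>v\<in>K ` {..n}. u v *\<^sub>R v) = 0"
      by (auto simp: dependent_finite)
    then obtain j where j: "j \<le> n" "u (K j) \<noteq> 0" by auto
    let ?p = "\<Sum>i\<le>n. smult (of_real (u (K i))) (monom 1 i)"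
    have "coeff ?p j = of_real (u (K j))"
      using j(1) by (simp add: coeff_sum if_distrib[of "\<lambda>x. _ * x"] cong: if_cong)
    then have "?p \<noteq> 0" using j(2) by (metis coeff_0 of_real_eq_0_iff)
    moreover have "poly_act D M ?p = (\<Sum>i\<le>n. u (K i) *\<^sub>R K i)"
      unfolding poly_act_sum poly_act_smult K_def[symmetric]
      by (intro sum.cong refl, unfold vec_eq_iff mat_mult_nth)
         (simp add: scaleR_conv_of_real[where 'a = complex])
    then have "poly_act D M ?p = 0"
      using u(2) by (simp add: sum.reindex[OF True])
    ultimately show ?thesis by (rule that)
  qed
qed

lemma eig_if_mult_eq_scalar_mult:
  assumes "N ** (Z :: complex ^ 'q ^ 'p) = mat z ** Z" and "Z \<noteq> 0"
  shows "z \<in> eig N"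
proof -
  obtain j where j: "column j Z \<noteq> 0"
    using assms(2) by (auto simp: vec_eq_iff column_def)
  have "N *v column j Z = column j (N ** Z)"
    by (simp add: vec_eq_iff column_def matrix_vector_mult_def matrix_matrix_mult_def)
  also have "\<dots> = z *s column j Z"
    unfolding assms(1) by (simp add: vec_eq_iff column_def mat_mult_nth)
  finally show ?thesis using j by (auto simp: eig_def)
qed

text \<open>
  Let \<open>p\<close> be a nonzero polynomial of least degree with \<open>D p(M) = 0\<close>. If \<open>D \<noteq> 0\<close>, then \<open>p\<close> has a
  root \<open>z\<close>, say \<open>p = (x - z) q\<close>, and \<open>Z = D q(M)\<close> is nonzero by minimality. It satisfies
  \<open>Z M = z Z\<close>, and \<open>N Z = Z M\<close> because \<open>N\<close> passes through \<open>D\<close>. So a nonzero column of \<open>Z\<close> is an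
  eigenvector of \<open>N\<close> and a nonzero row a left eigenvector of \<open>M\<close>, both for \<open>z\<close>.
\<close>

lemma intertwiner_eq_0:
  fixes D :: "complex ^ 'q ^ 'p"
  assumes ND: "N ** D = D ** M" and disj: "eig N \<inter> eig M = {}"
  shows "D = 0"
proof (rule ccontr)
  assume D: "D \<noteq> 0"
  have "\<exists>p. p \<noteq> 0 \<and> poly_act D M p = 0" by (metis exists_annihilating_poly)
  then obtain p where p: "p \<noteq> 0" "poly_act D M p = 0"
    and least: "\<And>q. q \<noteq> 0 \<Longrightarrow> poly_act D M q = 0 \<Longrightarrow> degree p \<le> degree q"
    using ex_has_least_nat[of "\<lambda>p. p \<noteq> 0 \<and> poly_act D M p = 0" _ degree] by blast
  have "\<not> constant (poly p)"
  proof
    assume "constant (poly p)"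
    then obtain c where c: "p = [:c:]" by (metis constant_degree degree_eq_zeroE)
    then have "mat c ** D = 0" using p(2) by (simp add: poly_act_pCons poly_act_0 zero_mult)
    then show False using c p(1) D by (auto simp: vec_eq_iff mat_mult_nth)
  qed
  then obtain z where "poly p z = 0" using fundamental_theorem_of_algebra by blast
  then obtain q where q: "p = [:- z, 1:] * q" by (metis dvdE poly_eq_0_iff_dvd)
  define Z where "Z = poly_act D M q"
  have q0: "q \<noteq> 0" using p(1) q by auto
  then have "degree p = Suc (degree q)" unfolding q by (subst degree_mult_eq) auto
  then have Z: "Z \<noteq> 0" using least[OF q0] by (auto simp: Z_def)
  have "p = smult (- z) q + pCons 0 q" unfolding q by simp
  then have "mat (- z) ** Z + Z ** M = 0"
    using p(2) poly_act_add[of D M "smult (- z) q" "pCons 0 q"]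
    unfolding poly_act_smult poly_act_pCons mat_0_mult Z_def by simp
  then have ZM: "Z ** M = mat z ** Z"
    by (simp add: vec_eq_iff mat_mult_nth add_eq_0_iff2)
  have NZ: "N ** Z = mat z ** Z"
    using poly_act_intertwine[OF ND, of q] ZM by (simp add: Z_def)
  have "z \<in> eig N" by (rule eig_if_mult_eq_scalar_mult[OF NZ Z])
  moreover have "transpose M ** transpose Z = mat z ** transpose Z"
  proof -
    have "transpose M ** transpose Z = transpose (mat z ** Z)"
      by (simp add: ZM matrix_transpose_mul[symmetric])
    also have "\<dots> = mat z ** transpose Z"
      by (simp add: vec_eq_iff transpose_def mat_mult_nth)
    finally show ?thesis .
  qed
  then have "z \<in> eig (transpose M)"
    by (rule eig_if_mult_eq_scalar_mult) (metis Z transpose_transpose transpose_zero)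
  ultimately show False using disj by (auto simp: eig_transpose)
qed

section \<open>Block matrices and the Riccati equation\<close>

lemma sum_UNIV_Plus: "(\<Sum>i\<in>UNIV. f i) = (\<Sum>i\<in>UNIV. f (Inl i)) + (\<Sum>i\<in>UNIV. f (Inr i))"
  for f :: "'a::finite + 'b::finite \<Rightarrow> 'c::comm_monoid_add"
  by (simp add: UNIV_Plus_UNIV[symmetric] sum.Plus del: UNIV_Plus_UNIV)

lemma block_mat_mult:
  "block_mat P Q R S ** block_mat P' Q' R' S' =
    block_mat (P ** P' + Q ** R') (P ** Q' + Q ** S') (R ** P' + S ** R') (R ** Q' + S ** S')"
  by (simp add: vec_eq_iff block_mat_def matrix_matrix_mult_def sum_UNIV_Plus split: sum.split)

lemma block_mat_add:
  "block_mat P Q R S + block_mat P' Q' R' S' = block_mat (P + P') (Q + Q') (R + R') (S + S')"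
  by (simp add: vec_eq_iff block_mat_def split: sum.split)

lemma block_mat_1: "block_mat (mat 1) 0 0 (mat 1) = mat 1"
  by (auto simp: vec_eq_iff block_mat_def mat_def split: sum.split)

lemma block_mat_eq_iff:
  "block_mat P Q R S = block_mat P' Q' R' S' \<longleftrightarrow> P = P' \<and> Q = Q' \<and> R = R' \<and> S = S'"
proof (intro iffI; (elim conjE)?)
  assume eq: "block_mat P Q R S = block_mat P' Q' R' S'"
  have "block_mat P Q R S $ i $ j = block_mat P' Q' R' S' $ i $ j" for i j by (simp add: eq)
  from this[of "Inl _" "Inl _"] this[of "Inl _" "Inr _"] this[of "Inr _" "Inl _"] this[of "Inr _" "Inr _"]
  show "P = P' \<and> Q = Q' \<and> R = R' \<and> S = S'"
    by (simp add: vec_eq_iff block_mat_def)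
qed simp

lemma transpose_block_mat:
  "transpose (block_mat P Q R S) = block_mat (transpose P) (transpose R) (transpose Q) (transpose S)"
  by (simp add: vec_eq_iff block_mat_def transpose_def split: sum.split)

definition block_vec :: "'a ^ 'm \<Rightarrow> 'a ^ 'k \<Rightarrow> 'a ^ ('m + 'k)" where
  "block_vec v w = (\<chi> i. case i of Inl i' \<Rightarrow> v $ i' | Inr i' \<Rightarrow> w $ i')"

lemma block_mat_mv: "block_mat P Q R S *v block_vec v w = block_vec (P *v v + Q *v w) (R *v v + S *v w)"
  by (simp add: vec_eq_iff block_mat_def block_vec_def matrix_vector_mult_def sum_UNIV_Plus split: sum.split)

lemma norm_block_vec: "(norm (block_vec v w))\<^sup>2 = (norm v)\<^sup>2 + (norm w)\<^sup>2"
  for v :: "complex ^ 'm" and w :: "complex ^ 'k"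
  by (simp add: norm_vec_def L2_set_def sum_nonneg sum_UNIV_Plus block_vec_def)

lemma block_mat_mv_norm_le:
  fixes P :: "complex ^ 'm ^ 'm" and Q :: "complex ^ 'k ^ 'm"
  shows "(norm (P *v v + Q *v w))\<^sup>2 + (norm (R *v v + S *v w))\<^sup>2
    \<le> (spec_norm (block_mat P Q R S))\<^sup>2 * ((norm v)\<^sup>2 + (norm w)\<^sup>2)"
  using power_mono[OF norm_mv_le norm_ge_zero, of "block_mat P Q R S" "block_vec v w" 2]
  by (simp only: block_mat_mv norm_block_vec power_mult_distrib)

text \<open>
  The lower left block of the similarity transform of \<open>block_mat P Q R S\<close> by the unit lower
  triangular matrix with block \<open>X\<close>.
\<close>

definition riccati ::
  "complex ^ 'm ^ 'm \<Rightarrow> complex ^ 'k ^ 'm \<Rightarrow> complex ^ 'm ^ 'k \<Rightarrow> complex ^ 'k ^ 'k \<Rightarrow>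
    complex ^ 'm ^ 'k \<Rightarrow> complex ^ 'm ^ 'k" where
  "riccati P Q R S X = R + S ** X - X ** P - X ** Q ** X"

lemma mult_zero_right: "(Y :: complex ^ 'n ^ 'm) ** 0 = 0"
  by (simp add: vec_eq_iff matrix_matrix_mult_def)

lemma uminus_mult: "(- Y) ** Z = - ((Y :: complex ^ 'n ^ 'm) ** Z)"
  by (simp add: vec_eq_iff matrix_matrix_mult_def sum_negf)

lemma matrix_inv_eqI:
  fixes A :: "complex ^ 'n ^ 'n"
  assumes "A ** B = mat 1"
  shows "matrix_inv A = B"
proof -
  have BA: "B ** A = mat 1" using assms matrix_left_right_inverse by blast
  have "A ** matrix_inv A = mat 1 \<and> matrix_inv A ** A = mat 1"
    unfolding matrix_inv_def by (rule someI[of _ B]) (simp add: assms BA)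
  then have "matrix_inv A ** A ** B = B" by simp
  then show ?thesis by (simp add: matrix_mul_assoc[symmetric] assms)
qed

lemma unit_triangular_similarity:
  fixes X :: "complex ^ 'm ^ 'k"
  shows "matrix_inv (block_mat (mat 1) 0 X (mat 1)) ** block_mat P Q R S ** block_mat (mat 1) 0 X (mat 1)
    = block_mat (P + Q ** X) Q (riccati P Q R S X) (S - X ** Q)"
proof -
  have "block_mat (mat 1) 0 X (mat 1) ** block_mat (mat 1) 0 (- X) (mat 1) = mat 1"
    by (simp add: block_mat_mult mult_zero_right zero_mult block_mat_1)
  then have "matrix_inv (block_mat (mat 1) 0 X (mat 1)) = block_mat (mat 1) 0 (- X) (mat 1)"
    by (rule matrix_inv_eqI)
  then show ?thesis
    by (simp add: block_mat_mult mult_zero_right zero_mult block_mat_eq_iff riccati_def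
        matrix_distribs uminus_mult)
qed

text \<open>
  The Riccati expression is \<open>[-X I] E [I; X]\<close>, and each outer factor has norm at most
  \<open>\<surd>(1 + \<parallel>X\<parallel>\<^sup>2)\<close>. Estimating the four blocks separately would give the weaker factor
  \<open>(1 + \<parallel>X\<parallel>)\<^sup>2\<close>, too large for the stated bound on the solution.
\<close>

lemma spec_norm_riccati_le:
  fixes E11 :: "complex ^ 'm ^ 'm" and E12 :: "complex ^ 'k ^ 'm"
  shows "spec_norm (riccati E11 E12 E21 E22 X)
    \<le> spec_norm (block_mat E11 E12 E21 E22) * (1 + (spec_norm X)\<^sup>2)"
proof (rule spec_norm_le)
  let ?\<epsilon> = "spec_norm (block_mat E11 E12 E21 E22)" and ?x = "spec_norm X"
  show "0 \<le> ?\<epsilon> * (1 + ?x\<^sup>2)" by (simp add: spec_norm_nonneg)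
  fix v
  let ?w = "X *v v"
  define f where "f = E11 *v v + E12 *v ?w"
  define g where "g = E21 *v v + E22 *v ?w"
  have "riccati E11 E12 E21 E22 X *v v = g - X *v f"
    by (simp add: riccati_def f_def g_def algebra_simps matrix_vector_mul_assoc[symmetric]
        matrix_vector_right_distrib)
  then have "norm (riccati E11 E12 E21 E22 X *v v) \<le> norm g + ?x * norm f"
    using norm_triangle_ineq4[of g "X *v f"] norm_mv_le[of X f] by simp
  also have "\<dots> \<le> ?\<epsilon> * (1 + ?x\<^sup>2) * norm v"
  proof (rule power2_le_imp_le)
    \<comment> \<open>Cauchy-Schwarz for the vectors \<open>(1, \<parallel>X\<parallel>)\<close> and \<open>(\<parallel>g\<parallel>, \<parallel>f\<parallel>)\<close>.\<close>
    have "0 \<le> (norm f - ?x * norm g)\<^sup>2" by simp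
    then have "(norm g + ?x * norm f)\<^sup>2 \<le> (1 + ?x\<^sup>2) * ((norm f)\<^sup>2 + (norm g)\<^sup>2)"
      by (simp add: power2_eq_square algebra_simps)
    also have "\<dots> \<le> (1 + ?x\<^sup>2) * (?\<epsilon>\<^sup>2 * ((norm v)\<^sup>2 + (norm ?w)\<^sup>2))"
      unfolding f_def g_def by (intro mult_left_mono block_mat_mv_norm_le) simp
    also have "\<dots> \<le> (1 + ?x\<^sup>2) * (?\<epsilon>\<^sup>2 * ((norm v)\<^sup>2 + (?x * norm v)\<^sup>2))"
      by (intro mult_left_mono add_left_mono power_mono norm_mv_le) auto
    finally show "(norm g + ?x * norm f)\<^sup>2 \<le> (?\<epsilon> * (1 + ?x\<^sup>2) * norm v)\<^sup>2"
      by (simp add: power2_eq_square algebra_simps)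
  qed (simp add: spec_norm_nonneg)
  finally show "norm (riccati E11 E12 E21 E22 X *v v) \<le> ?\<epsilon> * (1 + ?x\<^sup>2) * norm v" .
qed

text \<open>
  On the compact unit sphere of the spectral norm the Frobenius norm is bounded, and homogeneity
  carries that bound to every ball.
\<close>

lemma compact_spec_norm_cball: "compact {X :: complex ^ 'q ^ 'p. spec_norm X \<le> r}"
proof -
  have "bounded {Y :: complex ^ 'q ^ 'p. spec_norm Y = 1}"
    by (rule compact_imp_bounded[OF compact_spec_norm_sphere])
  then obtain K where K: "\<And>Y :: complex ^ 'q ^ 'p. spec_norm Y = 1 \<Longrightarrow> norm Y \<le> K" "0 < K"
    unfolding bounded_pos by blast
  have "norm X \<le> K * r" if "spec_norm X \<le> r" for X :: "complex ^ 'q ^ 'p"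
  proof (cases "X = 0")
    case False
    then have pos: "spec_norm X > 0"
      using spec_norm_nonneg[of X] spec_norm_eq_0[of X] by linarith
    then have "norm (inverse (spec_norm X) *\<^sub>R X) \<le> K" by (intro K) (simp add: spec_norm_scaleR)
    then have "norm X \<le> K * spec_norm X" using pos by (simp add: field_simps)
    also have "\<dots> \<le> K * r" using K(2) that by simp
    finally show ?thesis .
  next
    case True
    then show ?thesis using that K(2) spec_norm_nonneg[of X] by simp
  qed
  then have "bounded {X :: complex ^ 'q ^ 'p. spec_norm X \<le> r}" by (auto simp: bounded_iff)
  moreover have "closed {X :: complex ^ 'q ^ 'p. spec_norm X \<le> r}"
    by (intro closed_Collect_le continuous_on_spec_norm continuous_on_const)
  ultimately show ?thesis by (simp add: compact_eq_bounded_closed)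
qed

lemma convex_spec_norm_cball: "convex {X :: complex ^ 'q ^ 'p. spec_norm X \<le> r}"
proof (rule convexI, clarify)
  fix X Y :: "complex ^ 'q ^ 'p" and u v :: real
  assume *: "spec_norm X \<le> r" "spec_norm Y \<le> r" "0 \<le> u" "0 \<le> v" "u + v = 1"
  have "spec_norm (u *\<^sub>R X + v *\<^sub>R Y) \<le> u * spec_norm X + v * spec_norm Y"
    using spec_norm_triangle[of "u *\<^sub>R X" "v *\<^sub>R Y"] * by (simp add: spec_norm_scaleR)
  also have "\<dots> \<le> u * r + v * r" using * by (intro add_mono mult_left_mono)
  also have "\<dots> = r" using *(5) by (metis distrib_right mult_1)
  finally show "spec_norm (u *\<^sub>R X + v *\<^sub>R Y) \<le> r" .
qed

lemma spec_norm_riccati_rhs_le: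
  fixes E11 :: "complex ^ 'm ^ 'm" and E12 A12 :: "complex ^ 'k ^ 'm"
  shows "spec_norm (X ** A12 ** X - riccati E11 E12 E21 E22 X)
    \<le> spec_norm (block_mat E11 E12 E21 E22)
      + (spec_norm (block_mat E11 E12 E21 E22) + spec_norm A12) * (spec_norm X)\<^sup>2"
proof -
  have "spec_norm (X ** A12 ** X) \<le> spec_norm X * spec_norm A12 * spec_norm X"
    by (intro order_trans[OF spec_norm_mult] mult_right_mono spec_norm_mult spec_norm_nonneg)
  with spec_norm_diff[of "X ** A12 ** X" "riccati E11 E12 E21 E22 X"]
    spec_norm_riccati_le[of E11 E12 E21 E22 X]
  show ?thesis by (simp add: power2_eq_square algebra_simps)
qed

lemma riccati_eq_0_iff:
  "riccati (A11 + E11) (A12 + E12) E21 (A22 + E22) X = 0 \<longleftrightarrow>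
    A22 ** X - X ** A11 = X ** A12 ** X - riccati E11 E12 E21 E22 X"
  unfolding riccati_def by (simp add: matrix_distribs algebra_simps)

lemma sylvester_linear: "linear (\<lambda>Y :: complex ^ 'q ^ 'p. B ** Y - Y ** C)"
  by (rule linearI)
     (simp_all add: matrix_distribs, simp_all add: matrix_matrix_mult_def vec_eq_iff scaleR_sum_right scaleR_right_diff_distrib)

text \<open>
  A solution of norm \<open>x\<close> satisfies \<open>s x \<le> \<epsilon> + (\<epsilon> + a) x\<^sup>2\<close>, so for \<open>\<epsilon> + a > 0\<close> it lies
  outside the open interval between the two roots of the quadratic. The smaller root is \<open>r\<close>, and \<open>2 \<epsilon> / s\<close> lies below the
  vertex \<open>s / (2 (\<epsilon> + a))\<close>, so the bound \<open>x \<le> 2 \<epsilon> / s\<close> excludes the upper range. Writing the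
  root with the sum in the denominator also covers \<open>\<epsilon> + a = 0\<close>.
\<close>

lemma smaller_root_bound:
  fixes \<epsilon> a s :: real
  assumes nn: "0 \<le> \<epsilon>" "0 \<le> a" "0 < s" and small: "4 * \<epsilon> * (\<epsilon> + a) < s\<^sup>2"
  defines "r \<equiv> 2 * \<epsilon> / (s + sqrt (s\<^sup>2 - 4 * (a + \<epsilon>) * \<epsilon>))"
  shows "0 \<le> r" "r \<le> 2 * \<epsilon> / s" "\<epsilon> + (\<epsilon> + a) * r\<^sup>2 = s * r"
    and "\<And>x. s * x \<le> \<epsilon> + (\<epsilon> + a) * x\<^sup>2 \<Longrightarrow> x \<le> 2 * \<epsilon> / s \<Longrightarrow> x \<le> r"
proof -
  define D where "D = sqrt (s\<^sup>2 - 4 * (a + \<epsilon>) * \<epsilon>)"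
  have D: "0 \<le> D" "D\<^sup>2 = s\<^sup>2 - 4 * (a + \<epsilon>) * \<epsilon>"
    using small by (simp_all add: D_def algebra_simps)
  have r: "r = 2 * \<epsilon> / (s + D)" by (simp add: r_def D_def)
  show "0 \<le> r" unfolding r using nn D(1) by simp
  show le: "r \<le> 2 * \<epsilon> / s" unfolding r using nn D(1) by (intro divide_left_mono) auto
  have t: "s + D > 0" using nn D by simp
  have rt: "r * (s + D) = 2 * \<epsilon>" unfolding r using t by simp
  have eq: "(s + D)\<^sup>2 + 4 * (\<epsilon> + a) * \<epsilon> = 2 * s * (s + D)"
    using D(2) by (simp add: power2_eq_square algebra_simps)
  have "(\<epsilon> + (\<epsilon> + a) * r\<^sup>2) * (s + D)\<^sup>2 = \<epsilon> * (s + D)\<^sup>2 + (\<epsilon> + a) * (r * (s + D))\<^sup>2"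
    unfolding power_mult_distrib by (simp only: distrib_right mult.assoc)
  also have "\<dots> = \<epsilon> * ((s + D)\<^sup>2 + 4 * (\<epsilon> + a) * \<epsilon>)"
    unfolding rt by (simp add: power2_eq_square algebra_simps)
  also have "\<dots> = s * (2 * \<epsilon>) * (s + D)" unfolding eq by simp
  also have "\<dots> = s * r * (s + D)\<^sup>2" unfolding rt[symmetric] by (simp add: power2_eq_square)
  finally show root: "\<epsilon> + (\<epsilon> + a) * r\<^sup>2 = s * r" using t by simp
  fix x assume x: "s * x \<le> \<epsilon> + (\<epsilon> + a) * x\<^sup>2" "x \<le> 2 * \<epsilon> / s"
  have half: "2 * ((\<epsilon> + a) * u) < s" if "u \<le> 2 * \<epsilon> / s" for u
  proof -
    have "2 * ((\<epsilon> + a) * u) \<le> 2 * ((\<epsilon> + a) * (2 * \<epsilon> / s))"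
      using nn that by (intro mult_left_mono) auto
    also have "\<dots> = 4 * \<epsilon> * (\<epsilon> + a) / s" by simp
    also have "\<dots> < s" using small nn by (simp add: divide_less_eq power2_eq_square)
    finally show ?thesis .
  qed
  show "x \<le> r"
  proof (rule ccontr)
    assume "\<not> x \<le> r"
    then have "0 < x - r" by simp
    moreover have "0 \<le> (x - r) * ((\<epsilon> + a) * (x + r) - s)"
      using x(1) root by (simp add: power2_eq_square algebra_simps)
    ultimately have "s \<le> (\<epsilon> + a) * (x + r)" by (simp add: zero_le_mult_iff)
    then show False using half[OF x(2)] half[OF le] by (simp add: distrib_left)
  qed
qed

text \<open>
  The Sylvester operator \<open>T Y = A22 Y - Y A11\<close> is invertible because the separation is positive, and
  the Riccati equation is the fixed point equation of \<open>X \<mapsto> T\<^sup>-\<^sup>1 (X A12 X - riccati E11 E12 E21 E22 X)\<close>.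
  The condition on \<open>r\<close> says that this map sends the ball of radius \<open>r\<close> into itself, so Brouwer's
  theorem applies. The Lipschitz constant \<open>(2 \<epsilon> \<surd>(1 + r\<^sup>2) + 2 a r) / s\<close> that norm estimates give for
  this map can exceed 1, so they do not make it a contraction.
\<close>

lemma riccati_solution_exists:
  fixes A11 E11 :: "complex ^ 'm ^ 'm" and A12 E12 :: "complex ^ 'k ^ 'm"
  assumes sep: "0 < sep A22 A11"
    and r: "0 \<le> r"
      "spec_norm (block_mat E11 E12 E21 E22)
        + (spec_norm (block_mat E11 E12 E21 E22) + spec_norm A12) * r\<^sup>2 \<le> sep A22 A11 * r"
  shows "\<exists>X. spec_norm X \<le> r \<and> riccati (A11 + E11) (A12 + E12) E21 (A22 + E22) X = 0"
proof -
  define T where "T Y = A22 ** Y - Y ** A11" for Y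
  define \<Phi> where "\<Phi> X = X ** A12 ** X - riccati E11 E12 E21 E22 X" for X
  have lin: "linear T" unfolding T_def by (rule sylvester_linear)
  have sepT: "sep A22 A11 * spec_norm Y \<le> spec_norm (T Y)" for Y
    unfolding T_def by (rule sep_mult_le)
  have "inj T"
  proof (subst linear_injective_0[OF lin], intro allI impI)
    fix Y assume "T Y = 0"
    then have "sep A22 A11 * spec_norm Y \<le> 0" using sepT[of Y] spec_norm_eq_0[of "T Y"] by simp
    then have "spec_norm Y = 0" using sep spec_norm_nonneg[of Y] by (simp add: mult_le_0_iff)
    then show "Y = 0" by (simp add: spec_norm_eq_0)
  qed
  then obtain G where G: "linear G" "\<And>Y. T (G Y) = Y"
    using linear_injective_isomorphism[OF lin] by blast
  let ?S = "{X :: complex ^ 'm ^ 'k. spec_norm X \<le> r}"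
  have cont: "continuous_on ?S (\<lambda>X. G (\<Phi> X))"
  proof (rule continuous_on_compose2[OF linear_continuous_on[of G UNIV]])
    show "bounded_linear G" using G(1) by (simp add: linear_conv_bounded_linear)
    show "continuous_on ?S \<Phi>"
      unfolding \<Phi>_def riccati_def matrix_matrix_mult_def by (intro continuous_intros)
  qed simp
  have into: "(\<lambda>X. G (\<Phi> X)) \<in> ?S \<rightarrow> ?S"
  proof (intro funcsetI CollectI)
    fix X assume X: "X \<in> ?S"
    let ?\<epsilon> = "spec_norm (block_mat E11 E12 E21 E22)"
    have "sep A22 A11 * spec_norm (G (\<Phi> X)) \<le> spec_norm (\<Phi> X)" using sepT[of "G (\<Phi> X)"] by (simp add: G)
    also have "\<dots> \<le> ?\<epsilon> + (?\<epsilon> + spec_norm A12) * (spec_norm X)\<^sup>2"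
      unfolding \<Phi>_def by (rule spec_norm_riccati_rhs_le)
    also have "\<dots> \<le> ?\<epsilon> + (?\<epsilon> + spec_norm A12) * r\<^sup>2"
      using X by (intro add_left_mono mult_left_mono power_mono add_nonneg_nonneg spec_norm_nonneg) auto
    also have "\<dots> \<le> sep A22 A11 * r" by (rule r(2))
    finally show "spec_norm (G (\<Phi> X)) \<le> r" using sep by simp
  qed
  have "0 \<in> ?S" using r(1) spec_norm_eq_0[of "0 :: complex ^ 'm ^ 'k"] by simp
  then have "?S \<noteq> {}" by blast
  then obtain X where "X \<in> ?S" "G (\<Phi> X) = X"
    using brouwer[OF compact_spec_norm_cball convex_spec_norm_cball _ cont into] by blast
  then have "spec_norm X \<le> r" "T X = \<Phi> X" using G(2)[of "\<Phi> X"] by auto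
  then show ?thesis unfolding riccati_eq_0_iff T_def \<Phi>_def by blast
qed

section \<open>Spectra of the decoupled blocks\<close>

text \<open>
  An eigenvector \<open>v\<close> of the upper block yields the eigenvector \<open>(v, X v)\<close> of the perturbed matrix,
  hence an approximate eigenvector of the unperturbed block triangular matrix. Its second part is
  short because \<open>X\<close> is small.
\<close>

lemma eig_compression_subset:
  fixes A11 E11 :: "complex ^ 'm ^ 'm" and A12 E12 :: "complex ^ 'k ^ 'm"
    and E21 X :: "complex ^ 'm ^ 'k" and A22 E22 :: "complex ^ 'k ^ 'k"
  defines "\<epsilon> \<equiv> spec_norm (block_mat E11 E12 E21 E22)"
  assumes ric: "riccati (A11 + E11) (A12 + E12) E21 (A22 + E22) X = 0"
    and s: "0 < sep A22 A11" "4 * \<epsilon> * (\<epsilon> + spec_norm A12) < (sep A22 A11)\<^sup>2"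
    and X: "sep A22 A11 * spec_norm X \<le> 2 * \<epsilon>"
  shows "eig (A11 + E11 + (A12 + E12) ** X) \<subseteq> eig_eps (sqrt (\<epsilon> * (\<epsilon> + spec_norm A12))) A11"
proof
  fix z assume "z \<in> eig (A11 + E11 + (A12 + E12) ** X)"
  then obtain v where v: "norm v = 1" "(A11 + E11 + (A12 + E12) ** X) *v v = z *s v"
    by (rule exists_unit_eigenvector)
  define w where "w = X *v v"
  have r1: "A11 *v v - z *s v + A12 *v w = - (E11 *v v + E12 *v w)"
    unfolding v(2)[symmetric] w_def
    by (simp add: matrix_vector_mult_add_rdistrib matrix_vector_mul_assoc[symmetric])
  have "z *s w = X *v (z *s v)" by (simp add: w_def vec.scale)
  also have "\<dots> = (X ** (A11 + E11) + X ** (A12 + E12) ** X) *v v"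
    by (simp add: v(2)[symmetric] matrix_vector_mul_assoc matrix_distribs)
  also have "X ** (A11 + E11) + X ** (A12 + E12) ** X = E21 + (A22 + E22) ** X"
    using ric by (simp add: riccati_def algebra_simps)
  finally have r2: "A22 *v w - z *s w = - (E21 *v v + E22 *v w)"
    unfolding w_def
    by (simp add: matrix_vector_mult_add_rdistrib matrix_vector_mul_assoc[symmetric])
  show "z \<in> eig_eps (sqrt (\<epsilon> * (\<epsilon> + spec_norm A12))) A11"
  proof (rule block_eigenvector_pseudo_eigenvalue[OF v(1) _ s(2,1)])
    show "0 \<le> \<epsilon>" by (simp add: \<epsilon>_def spec_norm_nonneg)
    have "norm w \<le> spec_norm X" using norm_mv_le[of X v] v(1) by (simp add: w_def)
    then show "sep A22 A11 * norm w \<le> 2 * \<epsilon>"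
      using X s(1) by (meson mult_le_cancel_left_pos order_trans)
    show "sep A22 A11 \<le> \<delta> + \<eta>" if "z \<in> eig_eps \<delta> A11" "z \<in> eig_eps \<eta> A22" for \<delta> \<eta>
      using sep_le_of_common_pseudo_eigenvalue[OF that(2,1)] by simp
    show "(norm (A11 *v v - z *s v + A12 *v w))\<^sup>2 + (norm (A22 *v w - z *s w))\<^sup>2
        \<le> \<epsilon>\<^sup>2 * (1 + (norm w)\<^sup>2)"
      unfolding r1 r2 norm_minus_cancel \<epsilon>_def
      using block_mat_mv_norm_le[of E11 v E12 w E21 E22] v(1) by simp
  qed
qed

text \<open>
  A left eigenvector \<open>w\<close> of the lower block yields the left eigenvector \<open>(-X\<^sup>T w, w)\<close> of the perturbed
  matrix. After transposition the unperturbed matrix is again block triangular, with the two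
  diagonal blocks in exchanged roles.
\<close>

lemma eig_cocompression_subset:
  fixes A11 E11 :: "complex ^ 'm ^ 'm" and A12 E12 :: "complex ^ 'k ^ 'm"
    and E21 X :: "complex ^ 'm ^ 'k" and A22 E22 :: "complex ^ 'k ^ 'k"
  defines "\<epsilon> \<equiv> spec_norm (block_mat E11 E12 E21 E22)"
  assumes ric: "riccati (A11 + E11) (A12 + E12) E21 (A22 + E22) X = 0"
    and s: "0 < sep A22 A11" "4 * \<epsilon> * (\<epsilon> + spec_norm A12) < (sep A22 A11)\<^sup>2"
    and X: "sep A22 A11 * spec_norm X \<le> 2 * \<epsilon>"
  shows "eig (A22 + E22 - X ** (A12 + E12)) \<subseteq> eig_eps (sqrt (\<epsilon> * (\<epsilon> + spec_norm A12))) A22"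
proof
  note [simp del] = transpose_matrix_vector
  fix z assume "z \<in> eig (A22 + E22 - X ** (A12 + E12))"
  then have "z \<in> eig (transpose (A22 + E22 - X ** (A12 + E12)))" by (simp only: eig_transpose)
  then obtain w where w: "norm w = 1" "transpose (A22 + E22 - X ** (A12 + E12)) *v w = z *s w"
    by (rule exists_unit_eigenvector)
  define u where "u = - (transpose X *v w)"
  have r1: "transpose A22 *v w - z *s w + transpose A12 *v u = - (transpose E12 *v u + transpose E22 *v w)"
    unfolding w(2)[symmetric] u_def
    by (simp add: transpose_add transpose_diff matrix_transpose_mul matrix_vector_mult_add_rdistrib
        matrix_vector_mult_diff_rdistrib matrix_vector_mul_assoc[symmetric] vec.neg)
  have "z *s u = - (transpose X *v (z *s w))" by (simp add: u_def vec.scale)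
  also have "\<dots> = - (transpose ((A22 + E22) ** X - X ** (A12 + E12) ** X) *v w)"
    by (simp add: w(2)[symmetric] matrix_vector_mul_assoc matrix_transpose_mul[symmetric] matrix_distribs)
  also have "(A22 + E22) ** X - X ** (A12 + E12) ** X = X ** (A11 + E11) - E21"
    using ric by (simp add: riccati_def algebra_simps)
  finally have r2: "transpose A11 *v u - z *s u = - (transpose E11 *v u + transpose E21 *v w)"
    unfolding u_def
    by (simp add: transpose_add transpose_diff matrix_transpose_mul matrix_vector_mult_add_rdistrib
        matrix_vector_mult_diff_rdistrib matrix_vector_mul_assoc[symmetric] matrix_vector_right_distrib vec.neg)
  have "z \<in> eig_eps (sqrt (\<epsilon> * (\<epsilon> + spec_norm (transpose A12)))) (transpose A22)"
  proof (rule block_eigenvector_pseudo_eigenvalue[OF w(1)])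
    show "0 \<le> \<epsilon>" by (simp add: \<epsilon>_def spec_norm_nonneg)
    show "4 * \<epsilon> * (\<epsilon> + spec_norm (transpose A12)) < (sep A22 A11)\<^sup>2" "0 < sep A22 A11"
      using s by (simp_all add: spec_norm_transpose)
    have "norm u \<le> spec_norm X"
      using norm_mv_le[of "transpose X" w] w(1) by (simp add: u_def spec_norm_transpose)
    then show "sep A22 A11 * norm u \<le> 2 * \<epsilon>"
      using X s(1) by (meson mult_le_cancel_left_pos order_trans)
    show "sep A22 A11 \<le> \<delta> + \<eta>"
      if "z \<in> eig_eps \<delta> (transpose A22)" "z \<in> eig_eps \<eta> (transpose A11)" for \<delta> \<eta>
      using sep_le_of_common_pseudo_eigenvalue[of z \<delta> A22 \<eta> A11] that
      by (simp only: eig_eps_transpose)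
    have "spec_norm (block_mat (transpose E11) (transpose E21) (transpose E12) (transpose E22)) = \<epsilon>"
      unfolding \<epsilon>_def by (metis spec_norm_transpose transpose_block_mat)
    then show "(norm (transpose A22 *v w - z *s w + transpose A12 *v u))\<^sup>2
        + (norm (transpose A11 *v u - z *s u))\<^sup>2 \<le> \<epsilon>\<^sup>2 * (1 + (norm u)\<^sup>2)"
      unfolding r1 r2 norm_minus_cancel
      using block_mat_mv_norm_le[of "transpose E11" u "transpose E21" w "transpose E12" "transpose E22"] w(1)
      by (simp add: add.commute)
  qed
  then show "z \<in> eig_eps (sqrt (\<epsilon> * (\<epsilon> + spec_norm A12))) A22"
    by (simp only: eig_eps_transpose spec_norm_transpose)
qed

text \<open>
  For two solutions of the Riccati equation the right side vanishes, and \<open>X - Y\<close> intertwines the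
  lower block decoupled by \<open>Y\<close> with the upper block decoupled by \<open>X\<close>.
\<close>

lemma riccati_difference:
  "(S - Y ** Q) ** (X - Y) - (X - Y) ** (P + Q ** X) = riccati P Q R S X - riccati P Q R S Y"
  by (simp add: riccati_def matrix_distribs)

theorem theorem3p17:
  fixes A11 E11 :: "complex ^ 'm ^ 'm"
    and A12 E12 :: "complex ^ 'k ^ 'm"
    and E21 :: "complex ^ 'm ^ 'k"
    and A22 E22 :: "complex ^ 'k ^ 'k"
    and A E :: "complex ^ ('m + 'k) ^ ('m + 'k)"
    and s :: real
    and \<phi> :: "real \<Rightarrow> real"
    and M :: "complex ^ 'm ^ 'k \<Rightarrow> complex ^ 'm ^ 'm"
    and N :: "complex ^ 'm ^ 'k \<Rightarrow> complex ^ 'k ^ 'k"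
    and decouples :: "complex ^ 'm ^ 'k \<Rightarrow> bool"
  assumes A: "A = block_mat A11 A12 0 A22"
    and E: "E = block_mat E11 E12 E21 E22"
    and s: "s = sep A22 A11"
    and s_pos: "s > 0"
    and small: "4 * spec_norm E * (spec_norm E + spec_norm A12) < s\<^sup>2"
    and \<phi>: "\<And>\<epsilon>. \<epsilon> \<ge> 0 \<Longrightarrow> \<phi> \<epsilon> = sqrt (\<epsilon> * (\<epsilon> + spec_norm A12))"
    and M: "\<And>X. M X = A11 + E11 + (A12 + E12) ** X"
    and N: "\<And>X. N X = A22 + E22 - X ** (A12 + E12)"
    and decouples: "\<And>X. decouples X \<longleftrightarrow>
          matrix_inv (block_mat (mat 1) 0 X (mat 1)) ** (A + E) ** block_mat (mat 1) 0 X (mat 1)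
            = block_mat (M X) (A12 + E12) 0 (N X)"
  shows "(\<exists>!X. decouples X \<and> spec_norm X \<le> 2 * spec_norm E / s)
    \<and> (\<forall>X. decouples X \<and> spec_norm X \<le> 2 * spec_norm E / s \<longrightarrow>
          spec_norm X
            \<le> 2 * spec_norm E / (s + sqrt (s\<^sup>2 - 4 * (spec_norm A12 + spec_norm E) * spec_norm E)))
    \<and> 2 * spec_norm E / (s + sqrt (s\<^sup>2 - 4 * (spec_norm A12 + spec_norm E) * spec_norm E))
        \<le> 2 * spec_norm E / s
    \<and> eig_eps (\<phi> (spec_norm E)) A11 \<inter> eig_eps (\<phi> (spec_norm E)) A22 = {}
    \<and> (\<forall>X. decouples X \<and> spec_norm X \<le> 2 * spec_norm E / s \<longrightarrow>
          eig (M X) \<subseteq> eig_eps (\<phi> (spec_norm E)) A11 \<and>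
          eig (N X) \<subseteq> eig_eps (\<phi> (spec_norm E)) A22)"
proof -
  define \<epsilon> where "\<epsilon> = spec_norm E"
  define a where "a = spec_norm A12"
  define r where "r = 2 * \<epsilon> / (s + sqrt (s\<^sup>2 - 4 * (a + \<epsilon>) * \<epsilon>))"
  have nn: "0 \<le> \<epsilon>" "0 \<le> a" by (simp_all add: \<epsilon>_def a_def spec_norm_nonneg)
  have small': "4 * \<epsilon> * (\<epsilon> + a) < s\<^sup>2" using small by (simp add: \<epsilon>_def a_def)
  have phi: "\<phi> \<epsilon> = sqrt (\<epsilon> * (\<epsilon> + a))" using \<phi>[OF nn(1)] by (simp add: a_def)
  note root = smaller_root_bound[OF nn s_pos small', folded r_def]
  let ?ric = "riccati (A11 + E11) (A12 + E12) E21 (A22 + E22)"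
  have dec: "decouples X \<longleftrightarrow> ?ric X = 0" for X
    unfolding decouples A E block_mat_add unit_triangular_similarity block_mat_eq_iff M N
    by simp
  have bound: "spec_norm X \<le> r" if X: "decouples X" "spec_norm X \<le> 2 * \<epsilon> / s" for X
  proof (rule root(4)[OF _ X(2)])
    have "s * spec_norm X \<le> spec_norm (A22 ** X - X ** A11)" unfolding s by (rule sep_mult_le)
    also have "\<dots> = spec_norm (X ** A12 ** X - riccati E11 E12 E21 E22 X)"
      using X(1) unfolding dec riccati_eq_0_iff by simp
    also have "\<dots> \<le> \<epsilon> + (\<epsilon> + a) * (spec_norm X)\<^sup>2"
      unfolding \<epsilon>_def a_def E by (rule spec_norm_riccati_rhs_le)
    finally show "s * spec_norm X \<le> \<epsilon> + (\<epsilon> + a) * (spec_norm X)\<^sup>2" .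
  qed
  have disjoint: "eig_eps (\<phi> \<epsilon>) A11 \<inter> eig_eps (\<phi> \<epsilon>) A22 = {}"
  proof (rule ccontr)
    assume "eig_eps (\<phi> \<epsilon>) A11 \<inter> eig_eps (\<phi> \<epsilon>) A22 \<noteq> {}"
    then have "s \<le> 2 * \<phi> \<epsilon>"
      using sep_le_of_common_pseudo_eigenvalue[of _ "\<phi> \<epsilon>" A22 "\<phi> \<epsilon>" A11] by (auto simp: s)
    then have "s\<^sup>2 \<le> (2 * \<phi> \<epsilon>)\<^sup>2" using s_pos by (intro power_mono) auto
    then show False using small' nn by (simp add: phi power_mult_distrib)
  qed
  have spectra: "eig (M X) \<subseteq> eig_eps (\<phi> \<epsilon>) A11 \<and> eig (N X) \<subseteq> eig_eps (\<phi> \<epsilon>) A22"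
    if X: "decouples X" "spec_norm X \<le> 2 * \<epsilon> / s" for X
  proof -
    have "s * spec_norm X \<le> 2 * \<epsilon>" using X(2) s_pos by (simp add: field_simps)
    then show ?thesis
      unfolding M N phi a_def
      using eig_compression_subset[of A11 E11 A12 E12 E21 A22 E22 X]
        eig_cocompression_subset[of A11 E11 A12 E12 E21 A22 E22 X]
        X(1) s_pos small' unfolding dec s \<epsilon>_def E a_def by simp
  qed
  have unique: "X = Y"
    if X: "decouples X" "spec_norm X \<le> 2 * \<epsilon> / s" and Y: "decouples Y" "spec_norm Y \<le> 2 * \<epsilon> / s"
    for X Y
  proof -
    have "N Y ** (X - Y) = (X - Y) ** M X"
      using riccati_difference[of "A22 + E22" Y "A12 + E12" X "A11 + E11" E21] X(1) Y(1)
      unfolding M N dec by simp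
    moreover have "eig (N Y) \<inter> eig (M X) = {}"
      using spectra[OF X] spectra[OF Y] disjoint by blast
    ultimately have "X - Y = 0" by (rule intertwiner_eq_0)
    then show ?thesis by simp
  qed
  \<comment> \<open>The ball of radius \<open>r\<close> is invariant because \<open>r\<close> is a root of the quadratic.\<close>
  have "\<exists>X. spec_norm X \<le> r \<and> ?ric X = 0"
    by (rule riccati_solution_exists)
       (use s_pos root(1,3) in \<open>simp_all add: s \<epsilon>_def a_def E\<close>)
  then obtain X where X: "decouples X" "spec_norm X \<le> 2 * \<epsilon> / s"
    using root(2) unfolding dec by (meson order_trans)
  show ?thesis
    unfolding \<epsilon>_def[symmetric] a_def[symmetric] r_def[symmetric]
    using X unique bound root(2) disjoint spectra by blast
qed

end
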